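(* Let $\mathbb{K}$ be a field of characteristic different from $2$, let $\delta\in\mathbb{K}^\times$, and let $a,b\in\mathfrak{sl}_2(\mathbb{K})$ satisfy $\det(a)=\det(b)=-\delta\neq0$ and have cross-ratio $\operatorname{bir}(a,b)=4\chi\notin\{1,\infty\}$. Then the elements $C\in\mathrm{SL}_2(\mathbb{K})$ such that $CaC^{-1}=b$ are parametrized by the Pell–Fermat conic $$\{(x,y)\in\mathbb{K}\times\mathbb{K} : x^2-\delta y^2=\chi\}$$ via $$C(x,y)=x(\mathbf{1}+ba^{-1})+y(a+b).$$ In particular, $a$ and $b$ are conjugate by an element $C(x,y)\in\mathrm{SL}_2(\mathbb{K})$ if and only if $\operatorname{bir}(a,b)$ belongs to the subgroup of norms $\mathrm{N}_{\mathbb{K}}(\mathbb{K}[\sqrt\delta]^\times)\subset\mathbb{K}^\times$; and they are conjugate by an element $C(x,0)\in\mathrm{SL}_2(\mathbb{K})\cap\mathbb{K}[\{a,b\}]$ if and only if $\operatorname{bir}(a,b)$ belongs to the subgroup of squares $(\mathbb{K}^\times)^2\subset\mathbb{K}^\times$.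
   Context: $\mathfrak{sl}_2(\mathbb{K})$ is the space of trace-zero $2\times2$ matrices over $\mathbb{K}$, with the symmetric bilinear form $\langle a,b\rangle=-\tfrac12\operatorname{Tr}(ab)$ (so $\langle a,a\rangle=\det(a)$) and the bracket $\{a,b\}=\tfrac12(ab-ba)$. $\mathbf{1}$ is the identity matrix, and $\mathbb{K}[\{a,b\}]$ is the subalgebra of $2\times 2$ matrices generated by $\{a,b\}$, i.e. the span of $\mathbf{1}$ and $\{a,b\}$. For $a,b\in\mathfrak{sl}_2(\mathbb{K})$ with the same determinant $d\neq0$, put $\cos(a,b)=\langle a,b\rangle/d$. The cross-ratio $\operatorname{bir}(a,b)\in\mathbb{K}\cup\{\infty\}$ is given by $\frac{1}{\operatorname{bir}(a,b)}=\frac{1+\cos(a,b)}{2}$, i.e. $\operatorname{bir}(a,b)=\frac{2d}{d+\langle a,b\rangle}$ (equal to $\infty$ if $\langle a,b\rangle=-d$). Equivalently, it is the cross-ratio $\frac{(\alpha-\alpha')(\beta-\beta')}{(\alpha-\beta')(\beta-\alpha')}$ of the pairs of fixed points $(\alpha',\alpha)$ of $a$ and $(\beta',\beta)$ of $b$ on the projective line over $\mathbb{K}[\sqrt{-d}]$, ordered consistently by the choice of one square root $\sqrt{-d}$ (eigenvalues $-\sqrt{-d}$, $+\sqrt{-d}$). $\mathbb{K}[\sqrt\delta]=\mathbb{K}[X]/(X^2-\delta)$, with norm $\mathrm{N}_{\mathbb{K}}(x+y\sqrt\delta)=x^2-\delta y^2$. "Parametrized" means that $(x,y)\mapsto C(x,y)$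 is a bijection from the conic onto the set of $C\in\mathrm{SL}_2(\mathbb{K})$ with $CaC^{-1}=b$. *)

theory Defs
  imports "HOL-Analysis.Analysis" "HOL-Algebra.Algebraic_Closure_Type" "HOL-Algebra.QuotRing"
begin

definition smult_mat :: "'a::semiring_1 \<Rightarrow> 'a^'n^'m \<Rightarrow> 'a^'n^'m" (infixr \<open>*\<^sub>m\<close> 75)
  where "c *\<^sub>m A = map_matrix ((*) c) A"

definition sl2 :: "('a::field^2^2) set"
  where "sl2 = {a. trace a = 0}"

definition SL2 :: "('a::field^2^2) set"
  where "SL2 = {C. det C = 1}"

definition form :: "'a::field^2^2 \<Rightarrow> 'a^2^2 \<Rightarrow> 'a"
  where "form a b = - (1 / 2) * trace (a ** b)"

definition bracket :: "'a::field^2^2 \<Rightarrow> 'a^2^2 \<Rightarrow> 'a^2^2"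
  where "bracket a b = (1 / 2) *\<^sub>m (a ** b - b ** a)"

definition mat_subalgebra :: "('a::field^2^2) set \<Rightarrow> bool"
  where "mat_subalgebra S \<longleftrightarrow> mat 1 \<in> S \<and> (\<forall>A\<in>S. \<forall>B\<in>S. A + B \<in> S \<and> A ** B \<in> S)
    \<and> (\<forall>c. \<forall>A\<in>S. c *\<^sub>m A \<in> S)"

definition generated_algebra :: "'a::field^2^2 \<Rightarrow> ('a^2^2) set"
  where "generated_algebra m = mat_subalgebra hull {m}"

text \<open>The set \<open>K \<union> {\<infinity>}\<close> in which cross-ratios take their values.\<close>

datatype 'a proj_line = Finite 'a | Infinity

text \<open>\<open>cosine\<close> and \<open>bir\<close> are meant for trace-zero \<open>a\<close>, \<open>b\<close> with
  \<open>det a = det b \<noteq> 0\<close> over a field of characteristic other than 2.\<close>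

definition cosine :: "'a::field^2^2 \<Rightarrow> 'a^2^2 \<Rightarrow> 'a"
  where "cosine a b = form a b / det a"

definition bir :: "'a::field^2^2 \<Rightarrow> 'a^2^2 \<Rightarrow> 'a proj_line"
  where "bir a b = (if (1 + cosine a b) / 2 = 0 then Infinity
                    else Finite (1 / ((1 + cosine a b) / 2)))"

definition conj_mat :: "'a::field^2^2 \<Rightarrow> 'a^2^2 \<Rightarrow> 'a \<Rightarrow> 'a \<Rightarrow> 'a^2^2"
  where "conj_mat a b x y = x *\<^sub>m (mat 1 + b ** matrix_inv a) + y *\<^sub>m (a + b)"

text \<open>\<open>quad_ext \<delta>\<close> is the ring \<open>K[X]/(X\<^sup>2 - \<delta>)\<close>; it is not assumed to be a field.
  Its elements are cosets, \<open>quad_elem \<delta> x y\<close> being the class of \<open>x + y X\<close>,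
  i.e. \<open>x + y \<surd>\<delta>\<close>.\<close>

definition quad_ideal :: "'a::field \<Rightarrow> 'a poly set"
  where "quad_ideal \<delta> = PIdl\<^bsub>ring_of_type_algebra\<^esub> [:- \<delta>, 0, 1:]"

definition quad_ext :: "'a::field \<Rightarrow> 'a poly set ring"
  where "quad_ext \<delta> = ring_of_type_algebra Quot (quad_ideal \<delta>)"

definition quad_elem :: "'a::field \<Rightarrow> 'a \<Rightarrow> 'a \<Rightarrow> 'a poly set"
  where "quad_elem \<delta> x y = quad_ideal \<delta> +>\<^bsub>ring_of_type_algebra\<^esub> [:x, y:]"

definition quad_norm :: "'a::field \<Rightarrow> 'a poly set \<Rightarrow> 'a"
  where "quad_norm \<delta> z = (THE n. \<exists>x y. z = quad_elem \<delta> x y \<and> n = x\<^sup>2 - \<delta> * y\<^sup>2)"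

definition norm_group :: "'a::field \<Rightarrow> 'a set"
  where "norm_group \<delta> = quad_norm \<delta> ` Units (quad_ext \<delta>)"

definition square_group :: "'a::field set"
  where "square_group = {z\<^sup>2 | z. z \<noteq> 0}"

text \<open>Every class has exactly one representative of degree at most 1, so the description in
  \<open>quad_norm\<close> does define a function on the quotient.\<close>

lemma quad_ideal_eq: "quad_ideal \<delta> = {p. [:- \<delta>, 0, 1:] dvd p}"
  by (auto simp: quad_ideal_def cgenideal_def ring_of_type_algebra_def dvd_def mult.commute)

lemma quad_coset_eq:
  "quad_ideal \<delta> +>\<^bsub>ring_of_type_algebra\<^esub> p = {q. [:- \<delta>, 0, 1:] dvd q - p}"
proof -
  have "\<exists>h. [:- \<delta>, 0, 1:] dvd h \<and> q = h + p" if "[:- \<delta>, 0, 1:] dvd q - p" for q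
    using that by (intro exI[of _ "q - p"]) simp
  then show ?thesis
    by (auto simp: a_r_coset_def r_coset_def quad_ideal_eq ring_of_type_algebra_def)
qed

lemma dvd_poly_eq_0:
  fixes \<delta> u v :: "'a::field"
  assumes "[:- \<delta>, 0, 1:] dvd [:u, v:]"
  shows "[:u, v:] = 0"
proof (rule ccontr)
  assume "[:u, v:] \<noteq> 0"
  then have "Polynomial.degree [:- \<delta>, 0, 1:] \<le> Polynomial.degree [:u, v:]"
    by (rule dvd_imp_degree_le[OF assms])
  then show False
    by (cases "v = 0") simp_all
qed

lemma quad_elem_inject:
  "quad_elem \<delta> x y = quad_elem \<delta> x' y' \<longleftrightarrow> x = x' \<and> y = y'"
proof
  assume eq: "quad_elem \<delta> x y = quad_elem \<delta> x' y'"
  have "[:x, y:] \<in> quad_elem \<delta> x y"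
    by (simp add: quad_elem_def quad_coset_eq)
  with eq have "[:x, y:] \<in> quad_elem \<delta> x' y'"
    by simp
  then have "[:- \<delta>, 0, 1:] dvd [:x - x', y - y':]"
    by (simp add: quad_elem_def quad_coset_eq)
  then have "[:x - x', y - y':] = 0"
    by (rule dvd_poly_eq_0)
  then show "x = x' \<and> y = y'" by simp
qed simp

lemma quad_norm_quad_elem: "quad_norm \<delta> (quad_elem \<delta> x y) = x\<^sup>2 - \<delta> * y\<^sup>2"
  by (simp add: quad_norm_def quad_elem_inject)

lemma carrier_ring_of_type: "carrier ring_of_type_algebra = UNIV"
  by (simp add: ring_of_type_algebra_def)

lemma carrier_quad_ext: "carrier (quad_ext \<delta>) = {quad_elem \<delta> x y | x y. True}"
proof -
  have "\<exists>x y. quad_ideal \<delta> +>\<^bsub>ring_of_type_algebra\<^esub> p = quad_elem \<delta> x y" for p :: "'a poly"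
  proof -
    define r where "r = p mod [:- \<delta>, 0, 1:]"
    have "Polynomial.degree r < 2"
      using degree_mod_less[of "[:- \<delta>, 0, 1:]" p] by (auto simp: r_def)
    then have r: "r = [:Polynomial.coeff r 0, Polynomial.coeff r 1:]"
      by (intro poly_eqI) (auto simp: coeff_pCons coeff_eq_0 split: nat.split)
    have "[:- \<delta>, 0, 1:] dvd p - r"
      unfolding r_def by (rule dvd_minus_mod)
    then have "[:- \<delta>, 0, 1:] dvd q - p \<longleftrightarrow> [:- \<delta>, 0, 1:] dvd q - r" for q
      using dvd_add_left_iff[of "[:- \<delta>, 0, 1:]" "p - r" "q - p"] by simp
    then have "quad_ideal \<delta> +>\<^bsub>ring_of_type_algebra\<^esub> p
        = quad_ideal \<delta> +>\<^bsub>ring_of_type_algebra\<^esub> r"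
      by (simp only: quad_coset_eq)
    also have "\<dots> = quad_elem \<delta> (Polynomial.coeff r 0) (Polynomial.coeff r 1)"
      by (simp only: quad_elem_def r[symmetric])
    finally show ?thesis by blast
  qed
  then show ?thesis
    unfolding quad_ext_def FactRing_def A_RCOSETS_def' partial_object.select_convs
    by (auto simp: quad_elem_def carrier_ring_of_type)
qed

end

theory Submission
  imports Defs
begin

text \<open>
  Put \<open>P = 1 + b a\<inverse>\<close>. For trace-zero matrices with the same determinant \<open>- \<delta>\<close>,
  Cayley--Hamilton gives \<open>a\<^sup>2 = b\<^sup>2 = \<delta>\<close>, hence \<open>P a = a + b = b P\<close>: the matrix \<open>P\<close>
  intertwines \<open>a\<close> and \<open>b\<close>, and it is invertible because \<open>det P = 2 (1 + cos(a, b)) = 1 / \<chi>\<close>.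
  All other intertwiners are therefore \<open>P E\<close> with \<open>E\<close> in the centralizer of \<open>a\<close>, which is
  the algebra \<open>K[a]\<close>, a copy of \<open>K[\<surd>\<delta>]\<close> on which the determinant is the norm:
  \<open>det (x + y a) = x\<^sup>2 - \<delta> y\<^sup>2\<close>. As \<open>P (x + y a) = x (1 + b a\<inverse>) + y (a + b)\<close> is \<open>C(x, y)\<close>,
  its determinant is \<open>(x\<^sup>2 - \<delta> y\<^sup>2) / \<chi>\<close>; requiring it to be 1 gives the conic.

  For the two criteria, the factor 4 between \<open>\<chi>\<close> and the cross-ratio is harmless, being the
  norm of 2 as well as its square; and \<open>C(x, 0) = x P\<close> is always in \<open>K[{a, b}]\<close>, because
  \<open>b a\<close> differs from \<open>- {a, b}\<close> by the scalar \<open>(a b + b a) / 2\<close>.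
\<close>

section \<open>Matrices of size two\<close>

lemmas entrywise = vec_eq_iff forall_2 sum_2 matrix_matrix_mult_def mat_def smult_mat_def
  det_2 trace_def

lemma smult_mat_mult_left: "(c *\<^sub>m A) ** B = c *\<^sub>m (A ** B)"
  for A B :: "'a::field^2^2"
  by (simp add: entrywise algebra_simps)

lemma smult_mat_mult_right: "A ** (c *\<^sub>m B) = c *\<^sub>m (A ** B)"
  for A B :: "'a::field^2^2"
  by (simp add: entrywise algebra_simps)

lemma matrix_add_rdistrib: "(A + B) ** C = A ** C + B ** C"
  for A B C :: "'a::field^2^2"
  by (simp add: entrywise algebra_simps)

lemma det_add_2:
  "det (A + B) = det A + det B + trace A * trace B - trace (A ** B)"
  for A B :: "'a::field^2^2"
  by (simp add: entrywise algebra_simps)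

text \<open>The polarized form of Cayley--Hamilton.\<close>

lemma anticommutator_trace_zero:
  fixes A B :: "'a::field^2^2"
  assumes "trace A = 0" and "trace B = 0"
  shows "A ** B + B ** A = trace (A ** B) *\<^sub>m mat 1"
proof -
  have "A$2$2 = - A$1$1" "B$2$2 = - B$1$1"
    using assms by (simp_all add: trace_def sum_2 eq_neg_iff_add_eq_0 add.commute)
  then show ?thesis by (simp add: entrywise algebra_simps)
qed

lemma square_trace_zero:
  fixes A :: "'a::field^2^2"
  assumes "trace A = 0"
  shows "A ** A = (- det A) *\<^sub>m mat 1"
proof -
  have "A$2$2 = - A$1$1"
    using assms by (simp add: trace_def sum_2 eq_neg_iff_add_eq_0 add.commute)
  then show ?thesis by (simp add: entrywise algebra_simps)
qed

lemma matrix_inv_mult: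
  fixes A :: "'a::field^2^2"
  assumes "det A \<noteq> 0"
  shows "A ** matrix_inv A = mat 1" and "matrix_inv A ** A = mat 1"
proof -
  have "\<exists>B. A ** B = mat 1 \<and> B ** A = mat 1"
    using assms invertible_det_nz[of A] by (simp add: invertible_def)
  then have "A ** matrix_inv A = mat 1 \<and> matrix_inv A ** A = mat 1"
    unfolding matrix_inv_def by (rule someI_ex)
  then show "A ** matrix_inv A = mat 1" and "matrix_inv A ** A = mat 1" by auto
qed

lemma conjugate_iff_intertwines:
  fixes A B C :: "'a::field^2^2"
  assumes "det C \<noteq> 0"
  shows "C ** A ** matrix_inv C = B \<longleftrightarrow> C ** A = B ** C"
proof
  assume "C ** A ** matrix_inv C = B"
  then have "B ** C = C ** A ** (matrix_inv C ** C)"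
    by (simp add: matrix_mul_assoc)
  then show "C ** A = B ** C"
    by (simp add: matrix_inv_mult[OF assms])
next
  assume "C ** A = B ** C"
  then have "C ** A ** matrix_inv C = B ** (C ** matrix_inv C)"
    by (simp add: matrix_mul_assoc)
  then show "C ** A ** matrix_inv C = B"
    by (simp add: matrix_inv_mult[OF assms])
qed

text \<open>Subtracting its trace part from \<open>E\<close> leaves a trace-zero \<open>D\<close> which commutes with \<open>A\<close>, so
  that the anticommutator \<open>2 D A\<close> is a scalar; multiplying by \<open>A\<close> makes \<open>D\<close> a multiple of \<open>A\<close>.\<close>

lemma centralizer_trace_zero:
  fixes A E :: "'a::field^2^2"
  assumes two: "(2::'a) \<noteq> 0" and A: "trace A = 0" "det A \<noteq> 0" and comm: "E ** A = A ** E"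
  shows "\<exists>x y. E = x *\<^sub>m mat 1 + y *\<^sub>m A"
proof -
  define D where "D = E + (- (trace E / 2)) *\<^sub>m mat 1"
  define t where "t = trace (D ** A)"
  have "trace D = 0"
    using two by (simp add: D_def entrywise field_simps)
  then have "D ** A + A ** D = t *\<^sub>m mat 1"
    unfolding t_def by (rule anticommutator_trace_zero) (rule A)
  moreover have "A ** D = D ** A"
    using comm by (simp add: D_def matrix_add_ldistrib matrix_add_rdistrib
        smult_mat_mult_left smult_mat_mult_right)
  ultimately have "(D ** A + D ** A) ** A = t *\<^sub>m A"
    by (simp add: smult_mat_mult_left)
  moreover have "(D ** A + D ** A) ** A = (2 * - det A) *\<^sub>m D"
  proof -
    have "(D ** A + D ** A) ** A = D ** (A ** A) + D ** (A ** A)"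
      by (simp only: matrix_add_rdistrib flip: matrix_mul_assoc)
    also have "\<dots> = (2 * - det A) *\<^sub>m D"
      unfolding square_trace_zero[OF A(1)]
      by (simp add: smult_mat_mult_right) (simp add: smult_mat_def vec_eq_iff)
    finally show ?thesis .
  qed
  ultimately have D: "(2 * - det A) *\<^sub>m D = t *\<^sub>m A" by simp
  have "D$i$j = t / (2 * - det A) * A$i$j" for i j
  proof -
    have "(2 * - det A) * D$i$j = t * A$i$j"
      using arg_cong[OF D, of "\<lambda>M. M$i$j"] by (simp add: smult_mat_def)
    moreover have "2 * - det A \<noteq> 0"
      using two A(2) by simp
    ultimately show ?thesis
      by (metis nonzero_mult_div_cancel_left times_divide_eq_left)
  qed
  then have "E = (trace E / 2) *\<^sub>m mat 1 + (t / (2 * - det A)) *\<^sub>m A"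
    by (simp add: D_def smult_mat_def vec_eq_iff mat_def diff_eq_eq)
  then show ?thesis by blast
qed

lemma det_centralizer:
  fixes A :: "'a::field^2^2"
  assumes "trace A = 0"
  shows "det (x *\<^sub>m mat 1 + y *\<^sub>m A) = x\<^sup>2 + det A * y\<^sup>2"
proof -
  have "A$2$2 = - A$1$1"
    using assms by (simp add: trace_def sum_2 eq_neg_iff_add_eq_0 add.commute)
  then show ?thesis by (simp add: entrywise algebra_simps power2_eq_square)
qed

lemma centralizer_coordinates_inject:
  fixes A :: "'a::field^2^2"
  assumes two: "(2::'a) \<noteq> 0" and A: "trace A = 0" "A \<noteq> 0"
    and eq: "x *\<^sub>m mat 1 + y *\<^sub>m A = x' *\<^sub>m mat 1 + y' *\<^sub>m A"
  shows "x = x' \<and> y = y'"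
proof -
  have tr: "trace (u *\<^sub>m mat 1 + v *\<^sub>m A) = 2 * u + v * trace A" for u v
    by (simp add: entrywise algebra_simps)
  have x: "x = x'"
    using arg_cong[OF eq, of trace] two by (simp add: tr A)
  obtain i j where "A$i$j \<noteq> 0"
    using A(2) by (auto simp: vec_eq_iff)
  with arg_cong[OF eq, of "\<lambda>M. M$i$j"] have "y = y'"
    by (simp add: x smult_mat_def)
  with x show ?thesis ..
qed

section \<open>The quadratic extension and its norm\<close>

text \<open>In the quotient, \<open>X\<^sup>2\<close> is replaced by \<open>\<delta>\<close>: the two representatives of the product differ
  by \<open>y y' (X\<^sup>2 - \<delta>)\<close>.\<close>

lemma quad_elem_mult:
  "quad_elem \<delta> x y \<otimes>\<^bsub>quad_ext \<delta>\<^esub> quad_elem \<delta> x' y'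
    = quad_elem \<delta> (x * x' + \<delta> * y * y') (x * y' + y * x')"
proof -
  let ?R = "ring_of_type_algebra :: 'a poly ring"
  interpret cring ?R by (rule cring_from_type_algebra)
  interpret ideal "quad_ideal \<delta>" ?R
    unfolding quad_ideal_def by (rule cgenideal_ideal) (simp add: carrier_ring_of_type)
  have "quad_elem \<delta> x y \<otimes>\<^bsub>quad_ext \<delta>\<^esub> quad_elem \<delta> x' y'
      = quad_ideal \<delta> +>\<^bsub>?R\<^esub> ([:x, y:] \<otimes>\<^bsub>?R\<^esub> [:x', y':])"
    by (simp add: quad_ext_def FactRing_def quad_elem_def rcoset_mult_add carrier_ring_of_type)
  also have "[:x, y:] \<otimes>\<^bsub>?R\<^esub> [:x', y':] = [:x, y:] * [:x', y':]"
    by (simp add: ring_of_type_algebra_def)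
  also have "\<dots> = [:x * x' + \<delta> * y * y', x * y' + y * x':] + Polynomial.smult (y * y') [:- \<delta>, 0, 1:]"
    by (simp add: algebra_simps)
  also have "quad_ideal \<delta> +>\<^bsub>?R\<^esub> \<dots>
      = quad_elem \<delta> (x * x' + \<delta> * y * y') (x * y' + y * x')"
  proof -
    have "d dvd q - (p + Polynomial.smult c d) \<longleftrightarrow> d dvd q - p" for c and d p q :: "'a poly"
      using dvd_diff_left_iff[of d "Polynomial.smult c d" "q - p"]
      by (simp add: diff_diff_eq dvd_smult)
    then show ?thesis
      by (simp only: quad_elem_def quad_coset_eq)
  qed
  finally show ?thesis .
qed

lemma one_quad_ext: "\<one>\<^bsub>quad_ext \<delta>\<^esub> = quad_elem \<delta> 1 0"
  by (simp add: quad_ext_def FactRing_def quad_elem_def ring_of_type_algebra_def one_pCons)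

text \<open>A unit has nonzero norm because the norm is multiplicative; conversely, an element of
  nonzero norm is inverted by its conjugate divided by the norm.\<close>

lemma norm_group_eq: "norm_group \<delta> = {n. n \<noteq> 0 \<and> (\<exists>x y. n = x\<^sup>2 - \<delta> * y\<^sup>2)}"
proof (intro equalityI subsetI)
  fix n assume "n \<in> norm_group \<delta>"
  then obtain z z' where z: "n = quad_norm \<delta> z" "z \<in> carrier (quad_ext \<delta>)"
      "z' \<in> carrier (quad_ext \<delta>)" "z \<otimes>\<^bsub>quad_ext \<delta>\<^esub> z' = \<one>\<^bsub>quad_ext \<delta>\<^esub>"
    by (auto simp: norm_group_def Units_def)
  then obtain x y x' y' where "z = quad_elem \<delta> x y" "z' = quad_elem \<delta> x' y'"
    by (auto simp: carrier_quad_ext)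
  with z have n: "n = x\<^sup>2 - \<delta> * y\<^sup>2"
    and inv: "x * x' + \<delta> * y * y' = 1" "x * y' + y * x' = 0"
    by (simp_all add: quad_norm_quad_elem quad_elem_mult one_quad_ext quad_elem_inject)
  have "n * (x'\<^sup>2 - \<delta> * y'\<^sup>2) = (x * x' + \<delta> * y * y')\<^sup>2 - \<delta> * (x * y' + y * x')\<^sup>2"
    by (simp add: n algebra_simps power2_eq_square)
  also have "\<dots> = 1" by (simp add: inv)
  finally have "n \<noteq> 0" by auto
  with n show "n \<in> {n. n \<noteq> 0 \<and> (\<exists>x y. n = x\<^sup>2 - \<delta> * y\<^sup>2)}" by blast
next
  fix n assume "n \<in> {n. n \<noteq> 0 \<and> (\<exists>x y. n = x\<^sup>2 - \<delta> * y\<^sup>2)}"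
  then obtain x y where n: "n \<noteq> 0" "n = x\<^sup>2 - \<delta> * y\<^sup>2" by blast
  have "x * (x / n) + \<delta> * y * (- y / n) = (x\<^sup>2 - \<delta> * y\<^sup>2) / n"
    by (simp add: power2_eq_square diff_divide_distrib)
  then have eq: "x * (x / n) + \<delta> * y * (- y / n) = 1"
    using n by simp
  have "quad_elem \<delta> x y \<in> Units (quad_ext \<delta>)"
    unfolding Units_def
  proof (intro CollectI conjI bexI)
    show "quad_elem \<delta> (x / n) (- y / n) \<otimes>\<^bsub>quad_ext \<delta>\<^esub> quad_elem \<delta> x y = \<one>\<^bsub>quad_ext \<delta>\<^esub>"
      "quad_elem \<delta> x y \<otimes>\<^bsub>quad_ext \<delta>\<^esub> quad_elem \<delta> (x / n) (- y / n) = \<one>\<^bsub>quad_ext \<delta>\<^esub>"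
      using eq by (simp_all add: quad_elem_mult one_quad_ext quad_elem_inject mult_ac)
  qed (auto simp: carrier_quad_ext)
  then have "quad_norm \<delta> (quad_elem \<delta> x y) \<in> norm_group \<delta>"
    unfolding norm_group_def by (rule imageI)
  then show "n \<in> norm_group \<delta>"
    using n by (simp add: quad_norm_quad_elem)
qed

section \<open>The intertwiners of two trace-zero matrices\<close>

locale sl2_pair =
  fixes \<delta> :: "'a::field" and a b :: "'a^2^2"
  assumes two_neq_0: "(2::'a) \<noteq> 0" and delta_neq_0: "\<delta> \<noteq> 0"
    and trace_a: "trace a = 0" and trace_b: "trace b = 0"
    and det_a: "det a = - \<delta>" and det_b: "det b = - \<delta>"
begin

text \<open>The intertwiner \<open>C(1, 0)\<close>, which serves as base point.\<close>

definition P :: "'a^2^2"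
  where "P = mat 1 + b ** matrix_inv a"

lemma a_inverse: "a ** matrix_inv a = mat 1" "matrix_inv a ** a = mat 1"
  using matrix_inv_mult[of a] delta_neq_0 by (simp_all add: det_a)

lemma a_square: "a ** a = \<delta> *\<^sub>m mat 1"
  using square_trace_zero[OF trace_a] by (simp add: det_a)

lemma b_square: "b ** b = \<delta> *\<^sub>m mat 1"
  using square_trace_zero[OF trace_b] by (simp add: det_b)

lemma P_a: "P ** a = a + b"
  by (simp add: P_def matrix_add_rdistrib a_inverse flip: matrix_mul_assoc)

lemma b_P: "b ** P = a + b"
proof -
  have "b ** b ** matrix_inv a = a ** a ** matrix_inv a"
    by (simp only: a_square b_square)
  also have "\<dots> = a"
    by (simp add: a_inverse flip: matrix_mul_assoc)
  finally show ?thesis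
    by (simp add: P_def matrix_add_ldistrib matrix_mul_assoc add.commute)
qed

lemma det_P: "det P = 2 * (1 + cosine a b)"
proof -
  have "det P * det a = det (a + b)"
    by (simp add: P_a flip: det_mul)
  also have "\<dots> = - (2 * \<delta> + trace (a ** b))"
    by (simp add: det_add_2 trace_a trace_b det_a det_b)
  finally show ?thesis
    using delta_neq_0 two_neq_0 by (simp add: cosine_def form_def det_a field_simps)
qed

lemma conj_mat_eq: "conj_mat a b x y = P ** (x *\<^sub>m mat 1 + y *\<^sub>m a)"
  by (simp add: conj_mat_def matrix_add_ldistrib smult_mat_mult_right P_a) (simp add: P_def)

lemma conj_mat_intertwines: "conj_mat a b x y ** a = b ** conj_mat a b x y"
proof -
  have "(x *\<^sub>m mat 1 + y *\<^sub>m a) ** a = a ** (x *\<^sub>m mat 1 + y *\<^sub>m a)"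
    by (simp add: matrix_add_ldistrib matrix_add_rdistrib smult_mat_mult_left smult_mat_mult_right)
  then have "conj_mat a b x y ** a = P ** a ** (x *\<^sub>m mat 1 + y *\<^sub>m a)"
    by (simp add: conj_mat_eq flip: matrix_mul_assoc)
  then show ?thesis
    by (simp add: conj_mat_eq P_a b_P matrix_mul_assoc)
qed

lemma det_conj_mat: "det (conj_mat a b x y) = det P * (x\<^sup>2 - \<delta> * y\<^sup>2)"
  by (simp add: conj_mat_eq det_mul det_centralizer trace_a det_a)

text \<open>This holds because \<open>P\<inverse> C\<close> centralizes \<open>a\<close>.\<close>

lemma intertwiner_is_conj_mat:
  assumes "det P \<noteq> 0" and C: "C ** a = b ** C"
  shows "\<exists>x y. C = conj_mat a b x y"
proof -
  note P_inverse = matrix_inv_mult[OF \<open>det P \<noteq> 0\<close>]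
  define E where "E = matrix_inv P ** C"
  have PE: "P ** E = C"
    by (simp add: E_def matrix_mul_assoc P_inverse)
  have "P ** (a ** E) = b ** (P ** E)"
    by (simp add: matrix_mul_assoc P_a b_P)
  also have "\<dots> = P ** (E ** a)"
    by (simp add: matrix_mul_assoc PE C)
  finally have "matrix_inv P ** P ** (a ** E) = matrix_inv P ** P ** (E ** a)"
    by (simp flip: matrix_mul_assoc)
  then have "E ** a = a ** E"
    by (simp add: P_inverse)
  then obtain x y where "E = x *\<^sub>m mat 1 + y *\<^sub>m a"
    using centralizer_trace_zero[OF two_neq_0 trace_a, of E] delta_neq_0 by (auto simp: det_a)
  with PE show ?thesis
    by (auto simp: conj_mat_eq)
qed

lemma conj_mat_inject:
  assumes "det P \<noteq> 0" and "conj_mat a b x y = conj_mat a b x' y'"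
  shows "x = x' \<and> y = y'"
proof -
  have "a \<noteq> 0"
    using delta_neq_0 det_a by (auto simp: det_2)
  have "matrix_inv P ** conj_mat a b u v = u *\<^sub>m mat 1 + v *\<^sub>m a" for u v
    by (simp add: conj_mat_eq matrix_mul_assoc matrix_inv_mult[OF \<open>det P \<noteq> 0\<close>])
  then show ?thesis
    using assms(2) centralizer_coordinates_inject[OF two_neq_0 trace_a \<open>a \<noteq> 0\<close>] by metis
qed

lemma P_in_generated_algebra: "P \<in> generated_algebra (bracket a b)"
proof -
  define m where "m = trace (a ** b) / 2"
  \<comment> \<open>\<open>b a = m - {a, b}\<close> and \<open>a\<inverse> = a / \<delta>\<close>\<close>
  have "(2 * m) *\<^sub>m mat 1 = a ** b + b ** a"
    using anticommutator_trace_zero[OF trace_a trace_b] two_neq_0 by (simp add: m_def)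
  then have ba: "b ** a = m *\<^sub>m mat 1 + (- 1) *\<^sub>m bracket a b"
    using two_neq_0 by (simp add: bracket_def smult_mat_def vec_eq_iff mat_def field_simps)
  have inv: "\<delta> *\<^sub>m matrix_inv a = a"
  proof -
    have "\<delta> *\<^sub>m matrix_inv a = a ** a ** matrix_inv a"
      by (simp add: a_square smult_mat_mult_left)
    also have "\<dots> = a"
      by (simp add: a_inverse flip: matrix_mul_assoc)
    finally show ?thesis .
  qed
  have "b ** a = \<delta> *\<^sub>m (b ** matrix_inv a)"
    by (subst inv[symmetric]) (simp add: smult_mat_mult_right)
  then have "b ** matrix_inv a = (1 / \<delta>) *\<^sub>m (b ** a)"
    using delta_neq_0 by (simp add: smult_mat_def vec_eq_iff)
  then have P: "P = mat 1 + (1 / \<delta>) *\<^sub>m (m *\<^sub>m mat 1 + (- 1) *\<^sub>m bracket a b)"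
    by (simp add: P_def ba)
  show ?thesis
    unfolding generated_algebra_def hull_def
  proof (rule InterI, clarify)
    fix S assume S: "mat_subalgebra S" "{bracket a b} \<subseteq> S"
    then have "mat 1 \<in> S" "bracket a b \<in> S"
      and "\<And>A B. A \<in> S \<Longrightarrow> B \<in> S \<Longrightarrow> A + B \<in> S" "\<And>c A. A \<in> S \<Longrightarrow> c *\<^sub>m A \<in> S"
      by (auto simp: mat_subalgebra_def)
    then show "P \<in> S"
      unfolding P by blast
  qed
qed

lemma conj_mat_0_in_generated_algebra: "conj_mat a b x 0 \<in> generated_algebra (bracket a b)"
proof -
  have "conj_mat a b x 0 = x *\<^sub>m P"
    by (simp add: conj_mat_def P_def smult_mat_def vec_eq_iff)
  then show ?thesis
    using P_in_generated_algebra
    by (auto simp: generated_algebra_def hull_def mat_subalgebra_def)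
qed

end

section \<open>Parametrization by the conic\<close>

theorem mainTheorem2:
  fixes \<delta> chi :: "'a::field" and a b :: "'a^2^2"
  assumes "CHAR('a) \<noteq> 2"
    and "\<delta> \<noteq> 0"
    and "a \<in> sl2" and "b \<in> sl2"
    and "det a = - \<delta>" and "det b = - \<delta>"
    and "bir a b = Finite (4 * chi)"
    and "bir a b \<notin> {Finite 1, Infinity}"
  shows "bij_betw (\<lambda>(x, y). conj_mat a b x y)
           {(x, y). x\<^sup>2 - \<delta> * y\<^sup>2 = chi}
           {C \<in> SL2. C ** a ** matrix_inv C = b}
    \<and> ((\<exists>x y. conj_mat a b x y \<in> SL2
               \<and> conj_mat a b x y ** a ** matrix_inv (conj_mat a b x y) = b)
         \<longleftrightarrow> bir a b \<in> Finite ` norm_group \<delta>)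
    \<and> ((\<exists>x. conj_mat a b x 0 \<in> SL2 \<inter> generated_algebra (bracket a b)
             \<and> conj_mat a b x 0 ** a ** matrix_inv (conj_mat a b x 0) = b)
         \<longleftrightarrow> bir a b \<in> Finite ` square_group)"
proof -
  have two: "(2::'a) \<noteq> 0"
  proof
    assume "(2::'a) = 0"
    then have "CHAR('a) dvd 2"
      using of_nat_eq_0_iff_char_dvd[of 2, where 'a='a] by simp
    then have "CHAR('a) \<le> 2"
      by (rule dvd_imp_le) simp
    moreover have "CHAR('a) \<noteq> 0"
      using \<open>CHAR('a) dvd 2\<close> by (metis dvd_0_left zero_neq_numeral)
    ultimately show False
      using assms(1) CHAR_not_1[where 'a='a] by linarith
  qed
  interpret sl2_pair \<delta> a b
    using assms two by unfold_locales (simp_all add: sl2_def)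
  have cos: "1 + cosine a b \<noteq> 0" "4 * chi = 2 / (1 + cosine a b)"
    using assms(7) two by (auto simp: bir_def split: if_splits)
  have four: "(4::'a) \<noteq> 0"
    using two no_zero_divisors[of "2::'a" 2] by simp
  have "det P \<noteq> 0"
    unfolding det_P using no_zero_divisors[OF two cos(1)] .
  have "4 * (det P * chi) = 2 * (4 * chi * (1 + cosine a b))"
    by (simp add: det_P algebra_simps)
  also have "\<dots> = 4"
    unfolding cos(2) using cos(1) by (simp del: distrib_left_numeral)
  finally have "4 * (det P * chi) = 4" .
  with four have det_P_chi: "det P * chi = 1" by simp
  then have "chi \<noteq> 0" by auto

  have det_iff: "det (conj_mat a b x y) = 1 \<longleftrightarrow> x\<^sup>2 - \<delta> * y\<^sup>2 = chi" for x y
    using det_P_chi \<open>det P \<noteq> 0\<close> mult_left_cancel[of "det P" "x\<^sup>2 - \<delta> * y\<^sup>2" chi]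
    by (simp add: det_conj_mat)
  have conjugates: "conj_mat a b x y ** a ** matrix_inv (conj_mat a b x y) = b"
    if "conj_mat a b x y \<in> SL2" for x y
    using that conjugate_iff_intertwines[of "conj_mat a b x y" a b] conj_mat_intertwines
    by (simp only: SL2_def mem_Collect_eq one_neq_zero not_False_eq_True simp_thms)

  have bir_mem: "bir a b \<in> Finite ` S \<longleftrightarrow> 4 * chi \<in> S" for S
    by (auto simp: assms(7))

  have bij: "bij_betw (\<lambda>(x, y). conj_mat a b x y) {(x, y). x\<^sup>2 - \<delta> * y\<^sup>2 = chi}
      {C \<in> SL2. C ** a ** matrix_inv C = b}"
  proof (rule bij_betw_imageI)
    show "inj_on (\<lambda>(x, y). conj_mat a b x y) {(x, y). x\<^sup>2 - \<delta> * y\<^sup>2 = chi}"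
      using conj_mat_inject[OF \<open>det P \<noteq> 0\<close>] by (auto intro!: inj_onI)
    show "(\<lambda>(x, y). conj_mat a b x y) ` {(x, y). x\<^sup>2 - \<delta> * y\<^sup>2 = chi}
        = {C \<in> SL2. C ** a ** matrix_inv C = b}"
    proof (intro equalityI subsetI)
      fix C assume C: "C \<in> {C \<in> SL2. C ** a ** matrix_inv C = b}"
      then have "det C = 1" "C ** a = b ** C"
        using conjugate_iff_intertwines[of C a b] by (auto simp: SL2_def)
      moreover from this obtain x y where "C = conj_mat a b x y"
        using intertwiner_is_conj_mat[OF \<open>det P \<noteq> 0\<close>] by blast
      ultimately show "C \<in> (\<lambda>(x, y). conj_mat a b x y) ` {(x, y). x\<^sup>2 - \<delta> * y\<^sup>2 = chi}"
        using det_iff by auto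
    qed (use det_iff conjugates in \<open>auto simp: SL2_def\<close>)
  qed

  have "(\<exists>x y. conj_mat a b x y \<in> SL2
             \<and> conj_mat a b x y ** a ** matrix_inv (conj_mat a b x y) = b)
      \<longleftrightarrow> (\<exists>x y. x\<^sup>2 - \<delta> * y\<^sup>2 = chi)"
    using conjugates det_iff by (auto simp: SL2_def)
  also have "\<dots> \<longleftrightarrow> (\<exists>x y. x\<^sup>2 - \<delta> * y\<^sup>2 = 4 * chi)"
  proof (intro iffI; elim exE)
    fix x y assume "x\<^sup>2 - \<delta> * y\<^sup>2 = chi"
    then have "(2 * x)\<^sup>2 - \<delta> * (2 * y)\<^sup>2 = 4 * chi"
      by (simp add: power_mult_distrib algebra_simps)
    then show "\<exists>x y. x\<^sup>2 - \<delta> * y\<^sup>2 = 4 * chi" by blast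
  next
    fix x y assume "x\<^sup>2 - \<delta> * y\<^sup>2 = 4 * chi"
    then have "(x / 2)\<^sup>2 - \<delta> * (y / 2)\<^sup>2 = chi"
      using four by (simp add: power_divide flip: diff_divide_distrib)
    then show "\<exists>x y. x\<^sup>2 - \<delta> * y\<^sup>2 = chi" by blast
  qed
  also have "\<dots> \<longleftrightarrow> bir a b \<in> Finite ` norm_group \<delta>"
    unfolding bir_mem norm_group_eq mem_Collect_eq eq_commute[of "4 * chi" "_ - _"]
    using \<open>chi \<noteq> 0\<close> four by simp
  finally have norms: "(\<exists>x y. conj_mat a b x y \<in> SL2
             \<and> conj_mat a b x y ** a ** matrix_inv (conj_mat a b x y) = b)
      \<longleftrightarrow> bir a b \<in> Finite ` norm_group \<delta>" .

  have "(\<exists>x. conj_mat a b x 0 \<in> SL2 \<inter> generated_algebra (bracket a b)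
             \<and> conj_mat a b x 0 ** a ** matrix_inv (conj_mat a b x 0) = b)
      \<longleftrightarrow> (\<exists>x. x\<^sup>2 = chi)"
    using conjugates det_iff[of _ 0] conj_mat_0_in_generated_algebra by (auto simp: SL2_def)
  also have "\<dots> \<longleftrightarrow> (\<exists>x. x \<noteq> 0 \<and> x\<^sup>2 = 4 * chi)"
  proof (intro iffI; elim exE)
    fix x assume "x\<^sup>2 = chi"
    then have "2 * x \<noteq> 0 \<and> (2 * x)\<^sup>2 = 4 * chi"
      using two \<open>chi \<noteq> 0\<close> by (auto simp: power_mult_distrib)
    then show "\<exists>x. x \<noteq> 0 \<and> x\<^sup>2 = 4 * chi" by blast
  next
    fix x assume "x \<noteq> 0 \<and> x\<^sup>2 = 4 * chi"
    then have "(x / 2)\<^sup>2 = chi"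
      using four by (simp add: power_divide)
    then show "\<exists>x. x\<^sup>2 = chi" by blast
  qed
  also have "\<dots> \<longleftrightarrow> bir a b \<in> Finite ` square_group"
    unfolding bir_mem square_group_def mem_Collect_eq by metis
  finally have squares: "(\<exists>x. conj_mat a b x 0 \<in> SL2 \<inter> generated_algebra (bracket a b)
             \<and> conj_mat a b x 0 ** a ** matrix_inv (conj_mat a b x 0) = b)
      \<longleftrightarrow> bir a b \<in> Finite ` square_group" .

  from bij norms squares show ?thesis by blast
qed

end
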